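(* Consider the left-invariant Lorentzian structure $g$ on $G=\mathrm{Aff}_+(\mathbb R)$ given by a matrix $A=\begin{pmatrix}a&b\\c&d\end{pmatrix}$, $|A|>0$, $a\ge0$, with sectional curvature $K\ne0$, and let $\pm=\operatorname{sgn}K$. Then the Lie algebra of Killing vector fields is $i(G)=\operatorname{span}(\widetilde X_1,\widetilde X_2,X_{\pm})$. The Lie brackets in this Lie algebra are $$[\widetilde X_1,\widetilde X_2]=\widetilde X_1,\qquad [\widetilde X_1,X_\pm]=\mp\frac{2\nu}{\lambda}\widetilde X_1+\frac2\lambda\widetilde X_2,\qquad [\widetilde X_2,X_\pm]=\frac{2(\lambda^2-\nu^2)}{\lambda}\widetilde X_1\pm\frac{2\nu}{\lambda}\widetilde X_2+X_\pm .$$ The Lie algebra $i(G)$ is isomorphic to the Lie algebra $\mathfrak{sl}(2)$ of the Lie group $\mathrm{SL}(2)$ of unimodular (real) $2\times2$ matrices.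
   Context: $G=\mathrm{Aff}_+(\mathbb R)=\{(x,y)\in\mathbb R^2: y>0\}$ with product $(x_2,y_2)\cdot(x_1,y_1)=(x_2+y_2x_1,\,y_2y_1)$ and identity $\mathrm{Id}=(0,1)$; left-invariant frame $X_1=y\,\partial_x$, $X_2=y\,\partial_y$. A real matrix $A=\begin{pmatrix}a&b\\c&d\end{pmatrix}$ with $|A|=ad-bc>0$ determines the left-invariant Lorentzian form $g(u_1X_1+u_2X_2)=-(au_1+bu_2)^2+(cu_1+du_2)^2$. Standing assumption of the paper: $a\ge0$. Write $A^{-1}=\begin{pmatrix}\alpha&\beta\\ \gamma&\delta\end{pmatrix}$. The sectional curvature is $K=(c^2-a^2)/|A|^2=\gamma^2-\delta^2$. Put $\Delta=\sqrt{|\gamma^2-\delta^2|}$, $\lambda=\frac{\alpha\delta-\beta\gamma}{\Delta^2}$, $\nu=\frac{\beta\delta-\alpha\gamma}{\Delta^2}$. A vector field $X$ on $G$ is Killing if $L_Xg=0$; $i(G)$ is the Lie algebra over $\mathbb R$ of Killing vector fields, with the usual bracket of vector fields (so that $[X_2,X_1]=X_1$). $\widetilde X_1=\partial_x$, $\widetilde X_2=x\,\partial_x+y\,\partial_y$ (right-invariant fields). If $K<0$: $X_-=\left(\lambda(y^2+w^2-1)+2\nu wy\right)\partial_x+2wy\,\partial_y$ with $w=\frac{x-\nu(y-1)}{\lambda}$. If $K>0$: $X_+=\left(\lambda(y^2+w^2-1)-2\nu wy\right)\partial_x+2wy\,\partial_y$ with $w=\frac{x+\nu(y-1)}{\lambda}$.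 *)

theory Defs
  imports "HOL-Analysis.Analysis" "HOL-Library.Function_Algebras"
begin

section \<open>Functions as a real vector space\<close>

instantiation "fun" :: (type, real_vector) real_vector
begin

definition scaleR_fun :: "real \<Rightarrow> ('a \<Rightarrow> 'b) \<Rightarrow> 'a \<Rightarrow> 'b"
  where "scaleR_fun c f = (\<lambda>x. c *\<^sub>R f x)"

instance
  by standard (auto simp: scaleR_fun_def fun_eq_iff algebra_simps)

end

section \<open>Lie algebras\<close>

definition lie_algebra :: "'a::real_vector set \<Rightarrow> ('a \<Rightarrow> 'a \<Rightarrow> 'a) \<Rightarrow> bool"
  where "lie_algebra V br \<longleftrightarrow>
    subspace V \<and>
    (\<forall>x\<in>V. \<forall>y\<in>V. br x y \<in> V) \<and>
    (\<forall>x\<in>V. \<forall>y\<in>V. \<forall>z\<in>V. br (x + y) z = br x z + br y z \<and> br z (x + y) = br z x + br z y) \<and>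
    (\<forall>c. \<forall>x\<in>V. \<forall>y\<in>V. br (c *\<^sub>R x) y = c *\<^sub>R br x y \<and> br x (c *\<^sub>R y) = c *\<^sub>R br x y) \<and>
    (\<forall>x\<in>V. br x x = 0) \<and>
    (\<forall>x\<in>V. \<forall>y\<in>V. \<forall>z\<in>V. br x (br y z) + br y (br z x) + br z (br x y) = 0)"

definition lie_isomorphic ::
  "'a::real_vector set \<Rightarrow> ('a \<Rightarrow> 'a \<Rightarrow> 'a) \<Rightarrow> 'b::real_vector set \<Rightarrow> ('b \<Rightarrow> 'b \<Rightarrow> 'b) \<Rightarrow> bool"
  where "lie_isomorphic V br W br' \<longleftrightarrow>
    lie_algebra V br \<and> lie_algebra W br' \<and>
    (\<exists>\<phi>. bij_betw \<phi> V W \<and>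
      (\<forall>x\<in>V. \<forall>y\<in>V. \<phi> (x + y) = \<phi> x + \<phi> y) \<and>
      (\<forall>c. \<forall>x\<in>V. \<phi> (c *\<^sub>R x) = c *\<^sub>R \<phi> x) \<and>
      (\<forall>x\<in>V. \<forall>y\<in>V. \<phi> (br x y) = br' (\<phi> x) (\<phi> y)))"

definition sl2 :: "(real^2^2) set"
  where "sl2 = {M. trace M = 0}"

lemma sl2_tangent_space:
  "sl2 = {M. \<exists>\<gamma>. (\<forall>t. det (\<gamma> t) = 1) \<and> \<gamma> 0 = mat 1 \<and>
    (\<gamma> has_vector_derivative M) (at (0::real))}"
proof (intro equalityI subsetI; (elim CollectE exE conjE)?)
  fix M assume "M \<in> sl2"
  then have M: "M$2$2 = - M$1$1" by (simp add: sl2_def trace_def UNIV_2)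
  define \<gamma> :: "real \<Rightarrow> real^2^2" where "\<gamma> t = vector [
    vector [(1 + t^2 * M$1$2 * M$2$1) * exp (t * M$1$1), t * M$1$2 * exp (- t * M$1$1)],
    vector [t * M$2$1 * exp (t * M$1$1), exp (- t * M$1$1)]]" for t
  have "det (\<gamma> t) = 1" for t
    by (simp add: det_2 \<gamma>_def exp_minus algebra_simps power2_eq_square)
  moreover have "\<gamma> 0 = mat 1"
    by (simp add: \<gamma>_def vec_eq_iff forall_2 mat_def)
  moreover have "((\<lambda>t. \<gamma> t $ i $ j) has_real_derivative M $ i $ j) (at 0)" for i j
    using exhaust_2[of i] exhaust_2[of j]
    by (auto simp: \<gamma>_def M intro!: derivative_eq_intros)
  then have "((\<lambda>t. \<gamma> t $ i $ j) has_vector_derivative M $ i $ j) (at 0)" for i j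
    by (simp add: has_real_derivative_iff_has_vector_derivative)
  then have "(\<gamma> has_vector_derivative M) (at 0)"
    unfolding has_vector_derivative_def
    by (subst has_derivative_componentwise_within) (auto simp: Basis_vec_def inner_axis)
  ultimately show "M \<in> {M. \<exists>\<gamma>. (\<forall>t. det (\<gamma> t) = 1) \<and> \<gamma> 0 = mat 1 \<and>
      (\<gamma> has_vector_derivative M) (at (0::real))}" by blast
next
  fix M :: "real^2^2" and \<gamma> :: "real \<Rightarrow> real^2^2"
  assume d: "\<forall>t. det (\<gamma> t) = 1" and 0: "\<gamma> 0 = mat 1" and D: "(\<gamma> has_vector_derivative M) (at 0)"
  have e: "((\<lambda>t. \<gamma> t $ i $ j) has_real_derivative M $ i $ j) (at 0)" for i j
    using bounded_linear.has_vector_derivative[OF bounded_linear_compose[OF bounded_linear_vec_nth bounded_linear_vec_nth] D]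
    by (simp add: has_real_derivative_iff_has_vector_derivative o_def)
  have "((\<lambda>t. det (\<gamma> t)) has_real_derivative M$1$1 + M$2$2) (at 0)"
    unfolding det_2 by (rule derivative_eq_intros e refl)+ (simp add: 0 mat_def)
  moreover have "((\<lambda>t. det (\<gamma> t)) has_real_derivative 0) (at 0)" using d by simp
  ultimately have "M$1$1 + M$2$2 = 0" by (rule DERIV_unique)
  then show "M \<in> sl2" by (simp add: sl2_def trace_def UNIV_2)
qed

definition commutator :: "real^2^2 \<Rightarrow> real^2^2 \<Rightarrow> real^2^2"
  where "commutator M N = M ** N - N ** M"

section \<open>The group and its vector fields\<close>

definition Aff :: "(real \<times> real) set"
  where "Aff = {(x, y). y > 0}"

definition aff_mult :: "real \<times> real \<Rightarrow> real \<times> real \<Rightarrow> real \<times> real"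
  where "aff_mult p q = (fst p + snd p * fst q, snd p * snd q)"

primrec Ck_on :: "nat \<Rightarrow> 'a::real_normed_vector set \<Rightarrow> ('a \<Rightarrow> 'b::real_normed_vector) \<Rightarrow> bool"
  where
    "Ck_on 0 S f \<longleftrightarrow> continuous_on S f"
  | "Ck_on (Suc k) S f \<longleftrightarrow>
      (\<forall>p\<in>S. f differentiable (at p)) \<and> (\<forall>v. Ck_on k S (\<lambda>p. frechet_derivative f (at p) v))"

definition smooth_on :: "'a::real_normed_vector set \<Rightarrow> ('a \<Rightarrow> 'b::real_normed_vector) \<Rightarrow> bool"
  where "smooth_on S f \<longleftrightarrow> (\<forall>k. Ck_on k S f)"

text \<open>
  A vector field on the open half plane is represented by its coefficients with respect to the
  coordinate fields \<open>\<partial>\<^sub>x, \<partial>\<^sub>y\<close>, that is, by a function from points to pairs. So that equal vector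
  fields are equal functions, every vector field takes the value 0 outside the half plane;
  \<open>on_Aff\<close> imposes this.
\<close>

type_synonym vfield = "real \<times> real \<Rightarrow> real \<times> real"

definition on_Aff :: "vfield \<Rightarrow> vfield"
  where "on_Aff X = (\<lambda>p. if p \<in> Aff then X p else 0)"

definition smooth_vfield :: "vfield \<Rightarrow> bool"
  where "smooth_vfield X \<longleftrightarrow> smooth_on Aff X \<and> (\<forall>p. p \<notin> Aff \<longrightarrow> X p = 0)"

definition lie_bracket :: "vfield \<Rightarrow> vfield \<Rightarrow> vfield"
  where "lie_bracket X Y =
    on_Aff (\<lambda>p. frechet_derivative Y (at p) (X p) - frechet_derivative X (at p) (Y p))"

definition L1 :: vfield
  where "L1 = on_Aff (\<lambda>(x, y). (y, 0))"

definition L2 :: vfield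
  where "L2 = on_Aff (\<lambda>(x, y). (0, y))"

definition R1 :: vfield
  where "R1 = on_Aff (\<lambda>(x, y). (1, 0))"

definition R2 :: vfield
  where "R2 = on_Aff (\<lambda>(x, y). (x, y))"

section \<open>Metrics, Killing fields and curvature\<close>

text \<open>A metric assigns to each point a bilinear form on \<open>\<real>\<^sup>2\<close>, in the coordinate basis.\<close>

type_synonym metric = "real \<times> real \<Rightarrow> real \<times> real \<Rightarrow> real \<times> real \<Rightarrow> real"

text \<open>
  \<open>(L\<^sub>X g)(u, v) = X (g (u, v)) - g ([X, u], v) - g (u, [X, v])\<close> on constant fields \<open>u, v\<close>,
  for which \<open>[X, u] = - D X u\<close>.
\<close>

definition lie_derivative :: "vfield \<Rightarrow> metric \<Rightarrow> metric"
  where "lie_derivative X g p u v =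
    frechet_derivative (\<lambda>q. g q u v) (at p) (X p)
      + g p (frechet_derivative X (at p) u) v
      + g p u (frechet_derivative X (at p) v)"

definition killing_fields :: "metric \<Rightarrow> vfield set"
  where "killing_fields g =
    {X. smooth_vfield X \<and> (\<forall>p\<in>Aff. \<forall>u v. lie_derivative X g p u v = 0)}"

text \<open>
  The Levi-Civita connection is \<open>\<nabla>\<^sub>u Y = D Y u + \<Gamma> (u, Y)\<close>, where \<open>\<Gamma> (u, v) = \<nabla>\<^sub>u v\<close> for constant
  fields \<open>u, v\<close> is given by the Koszul formula (all brackets of constant fields vanish).
\<close>

definition christoffel :: "metric \<Rightarrow> real \<times> real \<Rightarrow> real \<times> real \<Rightarrow> real \<times> real \<Rightarrow> real \<times> real"
  where "christoffel g p u v = (THE z. \<forall>w. 2 * g p z w =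
      frechet_derivative (\<lambda>q. g q v w) (at p) u
    + frechet_derivative (\<lambda>q. g q u w) (at p) v
    - frechet_derivative (\<lambda>q. g q u v) (at p) w)"

definition covariant_derivative ::
  "metric \<Rightarrow> real \<times> real \<Rightarrow> vfield \<Rightarrow> real \<times> real \<Rightarrow> real \<times> real"
  where "covariant_derivative g u Y p = frechet_derivative Y (at p) u + christoffel g p u (Y p)"

text \<open>\<open>R (u, v) w = \<nabla>\<^sub>u \<nabla>\<^sub>v w - \<nabla>\<^sub>v \<nabla>\<^sub>u w\<close> for constant fields \<open>u, v, w\<close>.\<close>

definition riemann ::
  "metric \<Rightarrow> real \<times> real \<Rightarrow> real \<times> real \<Rightarrow> real \<times> real \<Rightarrow> real \<times> real \<Rightarrow> real \<times> real"
  where "riemann g p u v w =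
    covariant_derivative g u (covariant_derivative g v (\<lambda>_. w)) p
      - covariant_derivative g v (covariant_derivative g u (\<lambda>_. w)) p"

text \<open>The sectional curvature of the tangent plane at \<open>p\<close>, computed from its basis \<open>\<partial>\<^sub>x, \<partial>\<^sub>y\<close>.\<close>

definition sectional_curvature :: "metric \<Rightarrow> real \<times> real \<Rightarrow> real"
  where "sectional_curvature g p = (let e1 = (1, 0); e2 = (0, 1) in
    g p (riemann g p e1 e2 e2) e1 / (g p e1 e1 * g p e2 e2 - (g p e1 e2)\<^sup>2))"

section \<open>The left-invariant Lorentzian structure of a matrix\<close>

text \<open>
  The polarization of the quadratic form \<open>-(a u\<^sub>1 + b u\<^sub>2)\<^sup>2 + (c u\<^sub>1 + d u\<^sub>2)\<^sup>2\<close>, where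
  \<open>u\<^sub>1 = fst u / snd p\<close> and \<open>u\<^sub>2 = snd u / snd p\<close> are the coefficients of \<open>u\<close> in the frame
  \<open>L1 p, L2 p\<close>.
\<close>

definition aff_metric :: "real^2^2 \<Rightarrow> metric"
  where "aff_metric A p u v =
    - ((A$1$1 * (fst u / snd p) + A$1$2 * (snd u / snd p))
        * (A$1$1 * (fst v / snd p) + A$1$2 * (snd v / snd p)))
    + (A$2$1 * (fst u / snd p) + A$2$2 * (snd u / snd p))
        * (A$2$1 * (fst v / snd p) + A$2$2 * (snd v / snd p))"

lemma aff_metric_frame:
  assumes "p \<in> Aff"
  shows "aff_metric A p (u1 *\<^sub>R L1 p + u2 *\<^sub>R L2 p) (u1 *\<^sub>R L1 p + u2 *\<^sub>R L2 p) =
    - (A$1$1 * u1 + A$1$2 * u2)\<^sup>2 + (A$2$1 * u1 + A$2$2 * u2)\<^sup>2"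
  using assms
  by (auto simp: aff_metric_def L1_def L2_def on_Aff_def Aff_def power2_eq_square)

lemma aff_metric_left_invariant:
  assumes "p \<in> Aff" "q \<in> Aff"
  shows "aff_metric A (aff_mult p q)
      (frechet_derivative (aff_mult p) (at q) u) (frechet_derivative (aff_mult p) (at q) v) =
    aff_metric A q u v"
proof -
  have "(aff_mult p has_derivative (\<lambda>h. (snd p * fst h, snd p * snd h))) (at q)"
    unfolding aff_mult_def by (auto intro!: derivative_eq_intros)
  then have "frechet_derivative (aff_mult p) (at q) = (\<lambda>h. (snd p * fst h, snd p * snd h))"
    by (rule frechet_derivative_at[symmetric])
  then show ?thesis
    using assms by (auto simp: aff_metric_def aff_mult_def Aff_def)
qed

definition Dlt :: "real^2^2 \<Rightarrow> real"
  where "Dlt A = (let B = matrix_inv A in sqrt \<bar>(B$2$1)\<^sup>2 - (B$2$2)\<^sup>2\<bar>)"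

definition lam :: "real^2^2 \<Rightarrow> real"
  where "lam A = (let B = matrix_inv A in (B$1$1 * B$2$2 - B$1$2 * B$2$1) / (Dlt A)\<^sup>2)"

definition nu :: "real^2^2 \<Rightarrow> real"
  where "nu A = (let B = matrix_inv A in (B$1$2 * B$2$2 - B$1$1 * B$2$1) / (Dlt A)\<^sup>2)"

definition X_minus :: "real^2^2 \<Rightarrow> vfield"
  where "X_minus A = on_Aff (\<lambda>(x, y). let w = (x - nu A * (y - 1)) / lam A in
    (lam A * (y\<^sup>2 + w\<^sup>2 - 1) + 2 * nu A * w * y, 2 * w * y))"

definition X_plus :: "real^2^2 \<Rightarrow> vfield"
  where "X_plus A = on_Aff (\<lambda>(x, y). let w = (x + nu A * (y - 1)) / lam A in
    (lam A * (y\<^sup>2 + w\<^sup>2 - 1) - 2 * nu A * w * y, 2 * w * y))"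

end

theory Submission
  imports Defs
begin

text \<open>
  Write the metric as \<open>(E dx\<^sup>2 + 2 F dx dy + G dy\<^sup>2) / y\<^sup>2\<close>. Its curvature is \<open>E / |A|\<^sup>2\<close>
  (\<open>sectional_curvature_half_plane_metric\<close>), so \<open>K \<noteq> 0\<close> means that the square can be completed:
  the metric is \<open>E (dz\<^sup>2 - \<mu> dy\<^sup>2) / y\<^sup>2\<close> with \<open>z = x + \<kappa> y\<close>, \<open>\<kappa> = F / E\<close> and
  \<open>\<mu> = |A|\<^sup>2 / E\<^sup>2 = \<lambda>\<^sup>2\<close>. Since \<open>\<nu> = F / |E|\<close>, the sign of \<open>K\<close> is the one in \<open>\<kappa> = \<plusminus> \<nu>\<close>.

  This metric is the analogue of the hyperbolic metric for the number \<open>\<zeta> = z + j y\<close> with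
  \<open>j\<^sup>2 = \<mu>\<close> in place of \<open>j\<^sup>2 = - 1\<close>. As in the hyperbolic plane, its Killing fields are the
  infinitesimal Moebius transformations \<open>(r + p \<zeta> + q \<zeta>\<^sup>2 / 2) \<partial>\<^sub>\<zeta>\<close>: that these are Killing is a
  computation (\<open>mobius_field_killing\<close>), and that there are no others follows by integrating the
  Killing equations in the coordinates \<open>(z, y)\<close> (\<open>killing_system_solution\<close>,
  \<open>killing_imp_mobius_field\<close>).

  The three fields of the theorem are members of this family for three linearly independent
  polynomials, the brackets are those of polynomials in one variable
  (\<open>lie_bracket_mobius_field\<close>), and the quadratic polynomials under this bracket are the usual
  model of \<open>sl(2)\<close> (\<open>lie_isomorphic_mobius_fields\<close>).
\<close>

section \<open>Smooth fields and their brackets\<close>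

lemma open_Aff: "open Aff"
proof -
  have *: "Aff = snd -` {0<..}" by (auto simp: Aff_def)
  show ?thesis unfolding * by (intro open_vimage_snd open_greaterThan)
qed

text \<open>
  Coinduction for smoothness: the derivatives of every order stay inside a class of differentiable
  functions that is closed under directional derivatives.
\<close>

lemma smooth_on_coinduct:
  assumes "P f"
    and diff: "\<And>f p. P f \<Longrightarrow> p \<in> S \<Longrightarrow> f differentiable (at p)"
    and step: "\<And>f v. P f \<Longrightarrow> P (\<lambda>p. frechet_derivative f (at p) v)"
  shows "smooth_on S f"
proof -
  have "Ck_on k S f" if "P f" for k f
    using that
  proof (induction k arbitrary: f)
    case 0
    then show ?case
      by (auto intro!: continuous_at_imp_continuous_on differentiable_imp_continuous_within diff)
  next
    case (Suc k)
    then show ?case by (auto intro: diff step)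
  qed
  then show ?thesis using \<open>P f\<close> by (simp add: smooth_on_def)
qed

lemma has_derivative_quadratic:
  fixes a b c d e k :: "'a::real_normed_vector"
  assumes "open S" "p \<in> S"
    and "\<And>x y. (x, y) \<in> S \<Longrightarrow>
      f (x, y) = a + x *\<^sub>R b + y *\<^sub>R c + x\<^sup>2 *\<^sub>R d + (x * y) *\<^sub>R e + y\<^sup>2 *\<^sub>R k"
  shows "(f has_derivative (\<lambda>v. fst v *\<^sub>R (b + (2 * fst p) *\<^sub>R d + snd p *\<^sub>R e)
      + snd v *\<^sub>R (c + fst p *\<^sub>R e + (2 * snd p) *\<^sub>R k))) (at p)"
proof (rule has_derivative_transform_within_open[OF _ assms(1,2)])
  show "((\<lambda>q. a + fst q *\<^sub>R b + snd q *\<^sub>R c + (fst q)\<^sup>2 *\<^sub>R d + (fst q * snd q) *\<^sub>R e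
      + (snd q)\<^sup>2 *\<^sub>R k) has_derivative (\<lambda>v. fst v *\<^sub>R (b + (2 * fst p) *\<^sub>R d + snd p *\<^sub>R e)
      + snd v *\<^sub>R (c + fst p *\<^sub>R e + (2 * snd p) *\<^sub>R k))) (at p)"
    by (rule derivative_eq_intros refl)+ (simp add: fun_eq_iff algebra_simps)
qed (use assms(3) in force)

lemma smooth_on_quadratic:
  fixes a b c d e k :: "'a::real_normed_vector"
  assumes "open S"
    and "\<And>x y. (x, y) \<in> S \<Longrightarrow>
      f (x, y) = a + x *\<^sub>R b + y *\<^sub>R c + x\<^sup>2 *\<^sub>R d + (x * y) *\<^sub>R e + y\<^sup>2 *\<^sub>R k"
  shows "smooth_on S f"
proof (rule smooth_on_coinduct)
  let ?P = "\<lambda>f. \<exists>a b c d e k. \<forall>x y. (x, y) \<in> S \<longrightarrow>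
      f (x, y) = a + x *\<^sub>R b + y *\<^sub>R c + x\<^sup>2 *\<^sub>R d + (x * y) *\<^sub>R e + y\<^sup>2 *\<^sub>R (k::'a)"
  show "?P f" using assms(2) by blast
  fix f :: "real \<times> real \<Rightarrow> 'a" assume "?P f"
  then obtain a b c d e k where f: "\<And>x y. (x, y) \<in> S \<Longrightarrow>
      f (x, y) = a + x *\<^sub>R b + y *\<^sub>R c + x\<^sup>2 *\<^sub>R d + (x * y) *\<^sub>R e + y\<^sup>2 *\<^sub>R k" by blast
  note D = has_derivative_quadratic[OF \<open>open S\<close> _ f]
  show "f differentiable (at p)" if "p \<in> S" for p
    using D[OF that] by (auto simp: differentiable_def)
  fix v
  have "frechet_derivative f (at (x, y)) v = (fst v *\<^sub>R b + snd v *\<^sub>R c)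
      + x *\<^sub>R (fst v *\<^sub>R 2 *\<^sub>R d + snd v *\<^sub>R e) + y *\<^sub>R (fst v *\<^sub>R e + snd v *\<^sub>R 2 *\<^sub>R k)
      + x\<^sup>2 *\<^sub>R 0 + (x * y) *\<^sub>R 0 + y\<^sup>2 *\<^sub>R 0" if "(x, y) \<in> S" for x y
    by (subst frechet_derivative_at[OF D[OF that], symmetric]) (simp_all add: f algebra_simps)
  then show "?P (\<lambda>p. frechet_derivative f (at p) v)" by blast
qed

lemma smooth_on_imp_differentiable: "smooth_on S f \<Longrightarrow> p \<in> S \<Longrightarrow> f differentiable (at p)"
  by (metis Ck_on.simps(2) smooth_on_def)

section \<open>The Moebius fields\<close>

text \<open>
  In the coordinates \<open>(z, y)\<close> with \<open>z = x + \<kappa> y\<close>, and with \<open>\<zeta> = z + j y\<close> for a number \<open>j\<close> with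
  \<open>j\<^sup>2 = \<mu>\<close>, this is the infinitesimal Moebius transformation \<open>(r + p \<zeta> + q \<zeta>\<^sup>2 / 2) \<partial>\<^sub>\<zeta>\<close>: its
  \<open>z\<close>-component is \<open>r + p z + q (z\<^sup>2 + \<mu> y\<^sup>2) / 2\<close> and its \<open>y\<close>-component is \<open>y (p + q z)\<close>.
  Passing from \<open>z\<close> back to \<open>x = z - \<kappa> y\<close> gives the coefficients below.
\<close>

definition mobius_field :: "real \<Rightarrow> real \<Rightarrow> real \<Rightarrow> real \<Rightarrow> real \<Rightarrow> vfield"
  where "mobius_field \<kappa> \<mu> p q r = on_Aff (\<lambda>(x, y).
    (r + p * x + q / 2 * (x\<^sup>2 + (\<mu> - \<kappa>\<^sup>2) * y\<^sup>2), y * (p + q * (x + \<kappa> * y))))"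

lemma mobius_field_eq:
  assumes "(x, y) \<in> Aff"
  shows "mobius_field \<kappa> \<mu> p q r (x, y) =
    (r, 0) + x *\<^sub>R (p, 0) + y *\<^sub>R (0, p) + x\<^sup>2 *\<^sub>R (q / 2, 0) + (x * y) *\<^sub>R (0, q)
      + y\<^sup>2 *\<^sub>R (q / 2 * (\<mu> - \<kappa>\<^sup>2), q * \<kappa>)"
  using assms by (simp add: mobius_field_def on_Aff_def power2_eq_square field_simps)

lemma mobius_field_add:
  "mobius_field \<kappa> \<mu> p q r + mobius_field \<kappa> \<mu> p' q' r' = mobius_field \<kappa> \<mu> (p + p') (q + q') (r + r')"
  by (auto simp: mobius_field_def on_Aff_def fun_eq_iff algebra_simps add_divide_distrib)

lemma mobius_field_scaleR:
  "c *\<^sub>R mobius_field \<kappa> \<mu> p q r = mobius_field \<kappa> \<mu> (c * p) (c * q) (c * r)"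
  by (auto simp: mobius_field_def on_Aff_def scaleR_fun_def fun_eq_iff algebra_simps)

lemma frechet_derivative_mobius_field:
  assumes "P \<in> Aff"
  shows "frechet_derivative (mobius_field \<kappa> \<mu> p q r) (at P) v =
    (fst v * (p + q * fst P) + snd v * (q * (\<mu> - \<kappa>\<^sup>2) * snd P),
     fst v * (q * snd P) + snd v * (p + q * (fst P + 2 * \<kappa> * snd P)))"
  by (subst frechet_derivative_at
      [OF has_derivative_quadratic[OF open_Aff assms mobius_field_eq], symmetric])
    (auto simp: algebra_simps)

lemma smooth_mobius_field: "smooth_vfield (mobius_field \<kappa> \<mu> p q r)"
  unfolding smooth_vfield_def
  using smooth_on_quadratic[OF open_Aff mobius_field_eq]
  by (auto simp: mobius_field_def on_Aff_def)

text \<open>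
  This is the one-variable bracket \<open>[a(\<zeta>) \<partial>\<^sub>\<zeta>, b(\<zeta>) \<partial>\<^sub>\<zeta>] = (a b' - a' b) \<partial>\<^sub>\<zeta>\<close> for quadratic
  polynomials, which explains why neither \<open>\<kappa>\<close> nor \<open>\<mu>\<close> enters the structure constants.
\<close>

lemma lie_bracket_mobius_field:
  "lie_bracket (mobius_field \<kappa> \<mu> p q r) (mobius_field \<kappa> \<mu> p' q' r') =
    mobius_field \<kappa> \<mu> (r * q' - q * r') (p * q' - q * p') (r * p' - p * r')"
proof
  fix P :: "real \<times> real"
  obtain x y where P: "P = (x, y)" by force
  show "lie_bracket (mobius_field \<kappa> \<mu> p q r) (mobius_field \<kappa> \<mu> p' q' r') P =
    mobius_field \<kappa> \<mu> (r * q' - q * r') (p * q' - q * p') (r * p' - p * r') P"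
    unfolding P
    by (cases "(x, y) \<in> Aff")
      (simp_all add: lie_bracket_def on_Aff_def frechet_derivative_mobius_field, 
       simp_all add: mobius_field_def on_Aff_def field_simps power2_eq_square)
qed

section \<open>The Lie algebra of Moebius fields\<close>

text \<open>
  The Lie algebra axioms for the bracket on the image are those of \<open>W\<close>, carried over by \<open>\<Phi>\<close>.
\<close>

lemma lie_isomorphic_image:
  assumes W: "lie_algebra W br'" and "linear \<Phi>" and inj: "inj_on \<Phi> W"
    and br: "\<And>x y. x \<in> W \<Longrightarrow> y \<in> W \<Longrightarrow> \<Phi> (br' x y) = br (\<Phi> x) (\<Phi> y)"
  shows "lie_isomorphic (\<Phi> ` W) br W br'"
proof -
  interpret linear \<Phi> by fact
  note L = W[unfolded lie_algebra_def]
  have sub: "subspace W" and cl: "\<And>x y. x \<in> W \<Longrightarrow> y \<in> W \<Longrightarrow> br' x y \<in> W"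
    using L by auto
  note cls = cl subspace_add[OF sub] subspace_scale[OF sub] subspace_0[OF sub]
  have "lie_algebra (\<Phi> ` W) br"
    unfolding lie_algebra_def
  proof (intro conjI)
    show "subspace (\<Phi> ` W)" using \<open>linear \<Phi>\<close> sub by (rule linear_subspace_image)
    show "\<forall>x\<in>\<Phi> ` W. \<forall>y\<in>\<Phi> ` W. br x y \<in> \<Phi> ` W"
      by (auto simp: cls simp flip: br)
    show "\<forall>x\<in>\<Phi> ` W. \<forall>y\<in>\<Phi> ` W. \<forall>z\<in>\<Phi> ` W.
        br (x + y) z = br x z + br y z \<and> br z (x + y) = br z x + br z y"
      using L by (simp add: cls flip: br add)
    show "\<forall>c. \<forall>x\<in>\<Phi> ` W. \<forall>y\<in>\<Phi> ` W.
        br (c *\<^sub>R x) y = c *\<^sub>R br x y \<and> br x (c *\<^sub>R y) = c *\<^sub>R br x y"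
      using L by (simp add: cls flip: br scale)
    show "\<forall>x\<in>\<Phi> ` W. br x x = 0"
      using L by (simp flip: br add: zero)
    show "\<forall>x\<in>\<Phi> ` W. \<forall>y\<in>\<Phi> ` W. \<forall>z\<in>\<Phi> ` W. br x (br y z) + br y (br z x) + br z (br x y) = 0"
      using L by (simp add: cls zero flip: br add)
  qed
  moreover have "bij_betw (inv_into W \<Phi>) (\<Phi> ` W) W"
    using bij_betw_inv_into inj inj_on_imp_bij_betw by blast
  moreover have inv: "inv_into W \<Phi> (\<Phi> x) = x" if "x \<in> W" for x
    using inj that by (rule inv_into_f_f)
  moreover have "\<forall>x\<in>\<Phi> ` W. \<forall>y\<in>\<Phi> ` W. inv_into W \<Phi> (x + y) = inv_into W \<Phi> x + inv_into W \<Phi> y"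
    by (simp add: inv cls flip: add)
  moreover have "\<forall>c. \<forall>x\<in>\<Phi> ` W. inv_into W \<Phi> (c *\<^sub>R x) = c *\<^sub>R inv_into W \<Phi> x"
    by (simp add: inv cls flip: scale)
  moreover have "\<forall>x\<in>\<Phi> ` W. \<forall>y\<in>\<Phi> ` W. inv_into W \<Phi> (br x y) = br' (inv_into W \<Phi> x) (inv_into W \<Phi> y)"
    by (simp add: inv cls flip: br)
  ultimately show ?thesis
    unfolding lie_isomorphic_def using W by blast
qed

lemma lie_algebra_sl2: "lie_algebra sl2 commutator"
proof -
  have distrib: "M ** (N + P) = M ** N + M ** P" "(M + N) ** P = M ** P + N ** P"
      "M ** (N - P) = M ** N - M ** P" "(M - N) ** P = M ** P - N ** P"
      "(c *\<^sub>R M) ** N = c *\<^sub>R (M ** N)" "M ** (c *\<^sub>R N) = c *\<^sub>R (M ** N)"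
    for M N P :: "real^2^2" and c :: real
    by (simp_all add: vec_eq_iff matrix_matrix_mult_def sum_2 algebra_simps)
  have "subspace sl2"
    by (simp add: subspace_def sl2_def trace_def sum_2 flip: distrib_left)
  moreover have "commutator M N \<in> sl2" for M N :: "real^2^2"
    by (simp add: sl2_def commutator_def trace_sub trace_mul_sym[of M N])
  moreover have "commutator M (commutator N P) + commutator N (commutator P M)
      + commutator P (commutator M N) = 0" for M N P
    by (simp add: commutator_def distrib matrix_mul_assoc)
  moreover have "commutator (M + N) P = commutator M P + commutator N P"
      "commutator P (M + N) = commutator P M + commutator P N"
      "commutator (c *\<^sub>R M) N = c *\<^sub>R commutator M N"
      "commutator M (c *\<^sub>R N) = c *\<^sub>R commutator M N"
      "commutator M M = 0" for M N P c
    by (simp_all add: commutator_def distrib scaleR_diff_right)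
  ultimately show ?thesis
    by (simp add: lie_algebra_def)
qed

text \<open>
  The Moebius transformations \<open>\<zeta> \<mapsto> (a \<zeta> + b) / (c \<zeta> + d)\<close> form a local action of \<open>SL(2)\<close>; a
  traceless matrix with entries \<open>a, b, c, - a\<close> generates the field \<open>(b + 2 a \<zeta> - c \<zeta>\<^sup>2) \<partial>\<^sub>\<zeta>\<close>. The generators of
  an action from the left reverse brackets, so the isomorphism is the negative of this map.
\<close>

lemma lie_isomorphic_mobius_fields:
  "lie_isomorphic {mobius_field \<kappa> \<mu> p q r | p q r. True} lie_bracket sl2 commutator"
proof -
  define \<Phi> :: "real^2^2 \<Rightarrow> vfield" where
    "\<Phi> M = mobius_field \<kappa> \<mu> (- 2 * M$1$1) (2 * M$2$1) (- M$1$2)" for M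
  have sl2D: "M$2$2 = - M$1$1" if "M \<in> sl2" for M
    using that by (simp add: sl2_def trace_def sum_2)
  have "linear \<Phi>"
    by (rule linearI) (simp_all add: \<Phi>_def mobius_field_add mobius_field_scaleR algebra_simps)
  moreover have "inj_on \<Phi> sl2"
  proof (rule inj_onI)
    fix M N assume MN: "M \<in> sl2" "N \<in> sl2" "\<Phi> M = \<Phi> N"
    have "\<Phi> M (x, 1) = \<Phi> N (x, 1)" for x using MN by simp
    then have *: "- M$1$2 - 2 * M$1$1 * x + M$2$1 * (x\<^sup>2 + (\<mu> - \<kappa>\<^sup>2)) =
          - N$1$2 - 2 * N$1$1 * x + N$2$1 * (x\<^sup>2 + (\<mu> - \<kappa>\<^sup>2))"
        "2 * M$2$1 * (x + \<kappa>) - 2 * M$1$1 = 2 * N$2$1 * (x + \<kappa>) - 2 * N$1$1" for x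
      by (simp_all add: \<Phi>_def mobius_field_def on_Aff_def Aff_def)
    have 21: "M$2$1 = N$2$1" using *(2)[of 0] *(2)[of 1] by (simp add: distrib_left)
    then have "M$1$1 = N$1$1" "M$1$2 = N$1$2" using *(2)[of 0] *(1)[of 0] by simp_all
    with MN 21 show "M = N" by (simp add: vec_eq_iff forall_2 sl2D)
  qed
  moreover have "\<Phi> (commutator M N) = lie_bracket (\<Phi> M) (\<Phi> N)" if "M \<in> sl2" "N \<in> sl2" for M N
    using that
    by (simp add: \<Phi>_def lie_bracket_mobius_field commutator_def matrix_matrix_mult_def sum_2 sl2D
        algebra_simps)
  moreover have "\<Phi> ` sl2 = {mobius_field \<kappa> \<mu> p q r | p q r. True}"
  proof -
    have "mobius_field \<kappa> \<mu> p q r \<in> \<Phi> ` sl2" for p q r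
      by (rule image_eqI[where x = "vector [vector [- p / 2, - r], vector [q / 2, p / 2]]"])
        (simp_all add: \<Phi>_def sl2_def trace_def sum_2)
    then show ?thesis by (auto simp: \<Phi>_def)
  qed
  ultimately show ?thesis
    using lie_isomorphic_image[OF lie_algebra_sl2] by metis
qed

section \<open>Half plane metrics and their curvature\<close>

definition sym_form :: "real \<Rightarrow> real \<Rightarrow> real \<Rightarrow> real \<times> real \<Rightarrow> real \<times> real \<Rightarrow> real"
  where "sym_form E F G u v =
    E * fst u * fst v + F * (fst u * snd v + snd u * fst v) + G * snd u * snd v"

definition half_plane_metric :: "real \<Rightarrow> real \<Rightarrow> real \<Rightarrow> metric"
  where "half_plane_metric E F G p u v = sym_form E F G u v / (snd p)\<^sup>2"

lemma aff_metric_eq_half_plane_metric: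
  "aff_metric A = half_plane_metric ((A$2$1)\<^sup>2 - (A$1$1)\<^sup>2) (A$2$1 * A$2$2 - A$1$1 * A$1$2)
    ((A$2$2)\<^sup>2 - (A$1$2)\<^sup>2)"
  unfolding aff_metric_def half_plane_metric_def sym_form_def fun_eq_iff
  by (simp add: divide_simps power2_eq_square) (simp add: algebra_simps)

lemma frechet_derivative_half_plane_metric:
  assumes "p \<in> Aff"
  shows "frechet_derivative (\<lambda>q. half_plane_metric E F G q u v) (at p) w =
    - (2 * snd w / (snd p)^3) * sym_form E F G u v"
proof -
  have "((\<lambda>q. half_plane_metric E F G q u v) has_derivative
      (\<lambda>w. - (2 * snd w / (snd p)^3) * sym_form E F G u v)) (at p)"
    unfolding half_plane_metric_def using assms
    by (auto intro!: derivative_eq_intros simp: Aff_def fun_eq_iff field_simps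
        power2_eq_square power3_eq_cube power4_eq_xxxx)
  then show ?thesis by (simp flip: frechet_derivative_at)
qed

lemma sym_form_nondegenerate:
  assumes "E * G - F\<^sup>2 \<noteq> 0" and eq: "\<And>w. sym_form E F G z w = sym_form E F G z' w"
  shows "z = z'"
proof -
  have 1: "E * (fst z - fst z') + F * (snd z - snd z') = 0"
    using eq[of "(1, 0)"] by (simp add: sym_form_def algebra_simps)
  have 2: "F * (fst z - fst z') + G * (snd z - snd z') = 0"
    using eq[of "(0, 1)"] by (simp add: sym_form_def algebra_simps)
  have "(E * G - F\<^sup>2) * (fst z - fst z') = 0" "(E * G - F\<^sup>2) * (snd z - snd z') = 0"
    using 1 2 by algebra+
  with assms(1) show ?thesis by (simp add: prod_eq_iff)
qed

text \<open>
  The vector \<open>(- F, E) / (E G - F\<^sup>2)\<close> is the gradient of \<open>y\<close> for the constant form, which is where the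
  derivative of the conformal factor \<open>1 / y\<^sup>2\<close> enters.
\<close>

definition christoffel_coeff :: "real \<Rightarrow> real \<Rightarrow> real \<Rightarrow> real \<times> real \<Rightarrow> real \<times> real \<Rightarrow> real \<times> real"
  where "christoffel_coeff E F G u v = snd u *\<^sub>R v + snd v *\<^sub>R u
    - (sym_form E F G u v / (E * G - F\<^sup>2)) *\<^sub>R (- F, E)"

lemma christoffel_half_plane_metric:
  assumes "p \<in> Aff" and nd: "E * G - F\<^sup>2 \<noteq> 0"
  shows "christoffel (half_plane_metric E F G) p u v =
    (- (1 / snd p)) *\<^sub>R christoffel_coeff E F G u v"
proof -
  have y: "snd p \<noteq> 0" using assms by (auto simp: Aff_def)
  let ?Z = "(- (1 / snd p)) *\<^sub>R christoffel_coeff E F G u v"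
  let ?rhs = "\<lambda>w. - (snd u * sym_form E F G v w + snd v * sym_form E F G u w
      - snd w * sym_form E F G u v) / snd p"
  have koszul: "(2 * half_plane_metric E F G p z w =
      frechet_derivative (\<lambda>q. half_plane_metric E F G q v w) (at p) u
    + frechet_derivative (\<lambda>q. half_plane_metric E F G q u w) (at p) v
    - frechet_derivative (\<lambda>q. half_plane_metric E F G q u v) (at p) w)
    \<longleftrightarrow> sym_form E F G z w = ?rhs w" for z w
    unfolding frechet_derivative_half_plane_metric[OF \<open>p \<in> Aff\<close>]
    unfolding half_plane_metric_def
    using y by (simp add: field_simps power2_eq_square power3_eq_cube) (rule iffI; linarith)
  have grad: "sym_form E F G (- F, E) w = (E * G - F\<^sup>2) * snd w" for w
    by (simp add: sym_form_def algebra_simps power2_eq_square)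
  have linear: "sym_form E F G (c *\<^sub>R (s *\<^sub>R a + t *\<^sub>R b - k *\<^sub>R n)) w = c *
      (s * sym_form E F G a w + t * sym_form E F G b w - k * sym_form E F G n w)" for c s t k a b n w
    by (simp add: sym_form_def algebra_simps)
  have Z: "sym_form E F G ?Z w = ?rhs w" for w
    unfolding christoffel_coeff_def linear grad using nd y by (simp add: field_simps)
  show ?thesis
    unfolding christoffel_def koszul
  proof (rule the_equality)
    show "\<forall>w. sym_form E F G ?Z w = ?rhs w" using Z by blast
    show "z = ?Z" if "\<forall>w. sym_form E F G z w = ?rhs w" for z
      using that by (intro sym_form_nondegenerate[OF nd]) (simp only: Z)
  qed
qed

lemma riemann_half_plane_metric:
  assumes p: "p \<in> Aff" and nd: "E * G - F\<^sup>2 \<noteq> 0"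
  shows "riemann (half_plane_metric E F G) p u v w = (1 / (snd p)\<^sup>2) *\<^sub>R
    (snd u *\<^sub>R christoffel_coeff E F G v w - snd v *\<^sub>R christoffel_coeff E F G u w
      + christoffel_coeff E F G u (christoffel_coeff E F G v w)
      - christoffel_coeff E F G v (christoffel_coeff E F G u w))"
proof -
  have y: "snd p \<noteq> 0" using p by (auto simp: Aff_def)
  have const: "covariant_derivative (half_plane_metric E F G) v (\<lambda>_. w) q =
      (- (1 / snd q)) *\<^sub>R christoffel_coeff E F G v w" if "q \<in> Aff" for q v w
    by (simp add: covariant_derivative_def christoffel_half_plane_metric[OF that nd])
  have "(covariant_derivative (half_plane_metric E F G) v (\<lambda>_. w) has_derivative
      (\<lambda>u. (snd u / (snd p)\<^sup>2) *\<^sub>R christoffel_coeff E F G v w)) (at p)" for v w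
  proof (rule has_derivative_transform_within_open[OF _ open_Aff p])
    show "((\<lambda>q. (- (1 / snd q)) *\<^sub>R christoffel_coeff E F G v w) has_derivative
        (\<lambda>u. (snd u / (snd p)\<^sup>2) *\<^sub>R christoffel_coeff E F G v w)) (at p)"
      using y by (auto intro!: derivative_eq_intros simp: field_simps power2_eq_square)
  qed (simp add: const)
  note D = frechet_derivative_at[OF this, symmetric]
  have scale: "christoffel_coeff E F G u (c *\<^sub>R z) = c *\<^sub>R christoffel_coeff E F G u z" for u c z
    by (simp add: christoffel_coeff_def sym_form_def prod_eq_iff algebra_simps add_divide_distrib)
  have "covariant_derivative (half_plane_metric E F G) u
      (covariant_derivative (half_plane_metric E F G) v (\<lambda>_. w)) p = (1 / (snd p)\<^sup>2) *\<^sub>R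
      (snd u *\<^sub>R christoffel_coeff E F G v w
        + christoffel_coeff E F G u (christoffel_coeff E F G v w))" for u v
    unfolding covariant_derivative_def[of _ u] D const[OF p]
      christoffel_half_plane_metric[OF p nd] scale
    by (simp add: scaleR_add_right power2_eq_square)
  then show ?thesis
    unfolding riemann_def by (simp add: algebra_simps)
qed

lemma sectional_curvature_half_plane_metric:
  assumes "p \<in> Aff" and nd: "E * G - F\<^sup>2 \<noteq> 0"
  shows "sectional_curvature (half_plane_metric E F G) p = - E / (E * G - F\<^sup>2)"
proof -
  define d where "d = E * G - F\<^sup>2"
  have y: "snd p \<noteq> 0" and d: "d \<noteq> 0" using assms by (auto simp: Aff_def d_def)
  have c22: "christoffel_coeff E F G (0, 1) (0, 1) = (G * F / d, 2 - G * E / d)"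
    and c12: "christoffel_coeff E F G (1, 0) (0, 1) = (1 + F * F / d, - (F * E / d))"
    by (simp_all add: christoffel_coeff_def sym_form_def d_def)
  have "snd (1, 0) *\<^sub>R christoffel_coeff E F G (0, 1) (0, 1)
      - snd (0, 1) *\<^sub>R christoffel_coeff E F G (1, 0) (0, 1)
      + christoffel_coeff E F G (1, 0) (christoffel_coeff E F G (0, 1) (0, 1))
      - christoffel_coeff E F G (0, 1) (christoffel_coeff E F G (1, 0) (0, 1)) =
    (- (E * G / d), E * F / d)"
    unfolding c12 c22 unfolding christoffel_coeff_def sym_form_def d_def[symmetric] using d
    by (simp add: field_simps) (simp add: d_def algebra_simps power2_eq_square)
  then have R: "riemann (half_plane_metric E F G) p (1, 0) (0, 1) (0, 1) =
      (1 / (snd p)\<^sup>2) *\<^sub>R (- (E * G / d), E * F / d)"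
    unfolding riemann_half_plane_metric[OF assms] by (rule arg_cong)
  have B: "sym_form E F G (- (E * G / d), E * F / d) (1, 0) = - E"
    using d by (simp add: sym_form_def field_simps) (simp add: d_def algebra_simps power2_eq_square)
  have "half_plane_metric E F G p (c *\<^sub>R u) v = c * (sym_form E F G u v / (snd p)\<^sup>2)" for c u v
    by (simp add: half_plane_metric_def sym_form_def algebra_simps add_divide_distrib)
  note this[of "1 / (snd p)\<^sup>2" "(- (E * G / d), E * F / d)" "(1, 0)", unfolded B]
  moreover have "half_plane_metric E F G p (1, 0) (1, 0) * half_plane_metric E F G p (0, 1) (0, 1)
      - (half_plane_metric E F G p (1, 0) (0, 1))\<^sup>2 = d / (snd p)^4"
    using y by (simp add: half_plane_metric_def sym_form_def d_def field_simps power2_eq_square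
        power4_eq_xxxx)
  ultimately have "sectional_curvature (half_plane_metric E F G) p =
      1 / (snd p)\<^sup>2 * (- E / (snd p)\<^sup>2) / (d / (snd p)^4)"
    unfolding sectional_curvature_def Let_def R by (simp only:)
  then show ?thesis
    using y d by (simp add: d_def power2_eq_square power4_eq_xxxx)
qed

section \<open>Solving the Killing equations\<close>

text \<open>
  The equations in the direction of \<open>s\<close> separate the variables: \<open>h = s \<phi>(z)\<close>, and \<open>f\<close> differs
  from \<open>\<mu> s\<^sup>2 \<phi>'(z) / 2\<close> by a function of \<open>z\<close>. That \<open>\<phi>'\<close> is constant can be seen with first derivatives
  only: the difference of \<open>f\<close> between two heights \<open>s\<close> is a multiple of \<open>\<phi>'\<close>, and its \<open>z\<close>-derivative
  vanishes because the \<open>z\<close>-derivative \<open>h / s = \<phi>\<close> of \<open>f\<close> does not depend on the height.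
\<close>

lemma killing_system_solution:
  fixes f h h' :: "real \<Rightarrow> real \<Rightarrow> real"
  assumes "\<mu> \<noteq> 0"
    and fz: "\<And>z s. s > 0 \<Longrightarrow> ((\<lambda>z. f z s) has_real_derivative h z s / s) (at z)"
    and fs: "\<And>z s. s > 0 \<Longrightarrow> ((\<lambda>s. f z s) has_real_derivative \<mu> * h' z s) (at s)"
    and hz: "\<And>z s. s > 0 \<Longrightarrow> ((\<lambda>z. h z s) has_real_derivative h' z s) (at z)"
    and hs: "\<And>z s. s > 0 \<Longrightarrow> ((\<lambda>s. h z s) has_real_derivative h z s / s) (at s)"
  obtains p q r where
    "\<And>z s. s > 0 \<Longrightarrow> f z s = r + p * z + q * (z\<^sup>2 + \<mu> * s\<^sup>2) / 2"
    "\<And>z s. s > 0 \<Longrightarrow> h z s = s * (p + q * z)"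
proof -
  have const: "g x = g y" if "\<And>s. s \<in> S \<Longrightarrow> (g has_real_derivative 0) (at s)"
      "connected S" "open S" "x \<in> S" "y \<in> S" for g :: "real \<Rightarrow> real" and S x y
    using has_field_derivative_0_imp_constant_on[OF that(1-3)] that(4,5)
    by (auto simp: constant_on_def)
  have halfline: "connected {0::real<..}" "open {0::real<..}" by simp_all
  define \<phi> where "\<phi> = (\<lambda>z. h z 1)"
  define \<psi> where "\<psi> z = h' z 1" for z
  have h: "h z s = s * \<phi> z" if "s > 0" for z s
  proof -
    have "h z s / s = h z 1 / 1"
    proof (rule const[where g = "\<lambda>s. h z s / s", OF _ halfline])
      fix t :: real assume "t \<in> {0<..}"
      then show "((\<lambda>s. h z s / s) has_real_derivative 0) (at t)"
        by (auto intro!: derivative_eq_intros hs simp: field_simps)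
    qed (use that in auto)
    then show ?thesis using that by (simp add: \<phi>_def field_simps)
  qed
  have h': "h' z s = s * \<psi> z" if "s > 0" for z s
  proof (rule DERIV_unique[OF hz[OF that]])
    have "(\<phi> has_real_derivative \<psi> z) (at z)" using hz[of 1 z] by (simp add: \<phi>_def \<psi>_def)
    then show "((\<lambda>z. h z s) has_real_derivative s * \<psi> z) (at z)"
      unfolding h[OF that] by (auto intro!: derivative_eq_intros)
  qed
  have f: "f z s = f z 1 + \<mu> * \<psi> z * (s\<^sup>2 - 1) / 2" if "s > 0" for z s
  proof -
    have "f z s - \<mu> * \<psi> z * s\<^sup>2 / 2 = f z 1 - \<mu> * \<psi> z * 1\<^sup>2 / 2"
    proof (rule const[where g = "\<lambda>s. f z s - \<mu> * \<psi> z * s\<^sup>2 / 2", OF _ halfline])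
      fix t :: real assume "t \<in> {0<..}"
      then show "((\<lambda>s. f z s - \<mu> * \<psi> z * s\<^sup>2 / 2) has_real_derivative 0) (at t)"
        by (auto intro!: derivative_eq_intros fs simp: h')
    qed (use that in auto)
    then show ?thesis by (simp add: field_simps)
  qed
  define q where "q = \<psi> 0"
  define p where "p = \<phi> 0"
  have \<psi>: "\<psi> z = q" for z
  proof -
    \<comment> \<open>Any two different heights would do in place of 1 and 2.\<close>
    have "f z 2 - f z 1 = f 0 2 - f 0 1"
    proof (rule const[where g = "\<lambda>z. f z 2 - f z 1" and S = UNIV])
      show "((\<lambda>z. f z 2 - f z 1) has_real_derivative 0) (at t)" for t
        by (auto intro!: derivative_eq_intros fz simp: h)
    qed auto
    then show ?thesis using f[of 2 z] f[of 2 0] \<open>\<mu> \<noteq> 0\<close> by (simp add: q_def)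
  qed
  have \<phi>: "\<phi> z = p + q * z" for z
  proof -
    have "\<phi> z - q * z = \<phi> 0 - q * 0"
    proof (rule const[where g = "\<lambda>z. \<phi> z - q * z" and S = UNIV])
      show "((\<lambda>z. \<phi> z - q * z) has_real_derivative 0) (at t)" for t
        unfolding \<phi>_def using \<psi>[of t]
        by (auto intro!: derivative_eq_intros hz simp: \<psi>_def)
    qed auto
    then show ?thesis by (simp add: p_def)
  qed
  have f1: "f z 1 = f 0 1 + p * z + q * z\<^sup>2 / 2" for z
  proof -
    have "f z 1 - p * z - q * z\<^sup>2 / 2 = f 0 1 - p * 0 - q * 0\<^sup>2 / 2"
    proof (rule const[where g = "\<lambda>z. f z 1 - p * z - q * z\<^sup>2 / 2" and S = UNIV])
      show "((\<lambda>z. f z 1 - p * z - q * z\<^sup>2 / 2) has_real_derivative 0) (at t)" for t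
        by (auto intro!: derivative_eq_intros fz simp: h \<phi>)
    qed auto
    then show ?thesis by simp
  qed
  show ?thesis
  proof (rule that[of "f 0 1 - \<mu> * q / 2" p q])
    show "f z s = f 0 1 - \<mu> * q / 2 + p * z + q * (z\<^sup>2 + \<mu> * s\<^sup>2) / 2" if "s > 0" for z s
      using f[OF that, of z] by (simp add: f1[of z] \<psi> field_simps)
    show "h z s = s * (p + q * z)" if "s > 0" for z s
      using h[OF that] by (simp add: \<phi>)
  qed
qed

lemma lie_derivative_half_plane_metric:
  assumes "P \<in> Aff"
  shows "lie_derivative X (half_plane_metric E F G) P u v =
    (sym_form E F G (frechet_derivative X (at P) u) v
      + sym_form E F G u (frechet_derivative X (at P) v)
      - 2 * (snd (X P) / snd P) * sym_form E F G u v) / (snd P)\<^sup>2"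
  unfolding lie_derivative_def frechet_derivative_half_plane_metric[OF assms]
  unfolding half_plane_metric_def using assms
  by (auto simp: Aff_def field_simps power2_eq_square power3_eq_cube)

text \<open>
  The coefficients \<open>E\<close>, \<open>E \<kappa>\<close>, \<open>E (\<kappa>\<^sup>2 - \<mu>)\<close> are those of \<open>E (dz\<^sup>2 - \<mu> dy\<^sup>2) / y\<^sup>2\<close> with
  \<open>z = x + \<kappa> y\<close>. Such a metric is a multiple of \<open>|d\<zeta>|\<^sup>2 / y\<^sup>2\<close>, and a Moebius transformation
  with denominator \<open>c \<zeta> + d\<close> divides \<open>d\<zeta>\<close> by \<open>(c \<zeta> + d)\<^sup>2\<close> and \<open>y\<close> by \<open>|c \<zeta> + d|\<^sup>2\<close>.
\<close>

lemma mobius_field_killing: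
  "mobius_field \<kappa> \<mu> p q r \<in> killing_fields (half_plane_metric E (E * \<kappa>) (E * (\<kappa>\<^sup>2 - \<mu>)))"
proof -
  have "lie_derivative (mobius_field \<kappa> \<mu> p q r) (half_plane_metric E (E * \<kappa>) (E * (\<kappa>\<^sup>2 - \<mu>)))
      P u v = 0" if P: "P \<in> Aff" for P u v
  proof -
    have "snd (mobius_field \<kappa> \<mu> p q r P) / snd P = p + q * (fst P + \<kappa> * snd P)"
      using P by (auto simp: mobius_field_def on_Aff_def Aff_def split: prod.split)
    then show ?thesis
      unfolding lie_derivative_half_plane_metric[OF P] frechet_derivative_mobius_field[OF P]
      by (simp add: sym_form_def) (simp add: algebra_simps power2_eq_square)
  qed
  then show ?thesis by (simp add: killing_fields_def smooth_mobius_field)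
qed

text \<open>
  In the frame \<open>\<partial>\<^sub>x\<close>, \<open>\<partial>\<^sub>y - \<kappa> \<partial>\<^sub>x\<close>, which is the coordinate frame of \<open>(z, y)\<close> and is orthogonal, the
  Killing equations become the system of \<open>killing_system_solution\<close> for the components of \<open>X\<close>
  in that frame.
\<close>

lemma killing_imp_mobius_field:
  assumes "E \<noteq> 0" "\<mu> \<noteq> 0"
    and X: "X \<in> killing_fields (half_plane_metric E (E * \<kappa>) (E * (\<kappa>\<^sup>2 - \<mu>)))"
  obtains p q r where "X = mobius_field \<kappa> \<mu> p q r"
proof -
  let ?B = "sym_form E (E * \<kappa>) (E * (\<kappa>\<^sup>2 - \<mu>))"
  let ?P = "\<lambda>z s. (z - \<kappa> * s, s)"
  define f where "f z s = fst (X (?P z s)) + \<kappa> * snd (X (?P z s))" for z s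
  define h where "h z s = snd (X (?P z s))" for z s
  define D where "D z s = frechet_derivative X (at (?P z s))" for z s
  have Aff: "?P z s \<in> Aff" if "s > 0" for z s using that by (simp add: Aff_def)
  have DX: "(X has_derivative D z s) (at (?P z s))" if "s > 0" for z s
    using X smooth_on_imp_differentiable[OF _ Aff[OF that]]
    by (auto simp: D_def killing_fields_def smooth_vfield_def frechet_derivative_works[symmetric])
  have killing: "?B (D z s u) v + ?B u (D z s v) = 2 * (h z s / s) * ?B u v" if "s > 0" for z s u v
  proof -
    have "lie_derivative X (half_plane_metric E (E * \<kappa>) (E * (\<kappa>\<^sup>2 - \<mu>))) (?P z s) u v = 0"
      using X Aff[OF that] unfolding killing_fields_def by blast
    then show ?thesis
      unfolding lie_derivative_half_plane_metric[OF Aff[OF that]]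
      using that by (simp add: D_def h_def)
  qed
  have killing_diag: "?B (D z s u) u = h z s / s * ?B u u" if "s > 0" for z s u
  proof -
    have "?B u (D z s u) = ?B (D z s u) u" by (simp add: sym_form_def algebra_simps)
    then show ?thesis using killing[OF that, of z u u] by linarith
  qed
  have horizontal: "?B u (1, 0) = E * (fst u + \<kappa> * snd u)" "?B (1, 0) u = E * (fst u + \<kappa> * snd u)"
    and vertical: "?B u (- \<kappa>, 1) = - (E * \<mu>) * snd u" for u
    by (simp_all add: sym_form_def algebra_simps power2_eq_square)
  have eqs: "fst (D z s (1, 0)) + \<kappa> * snd (D z s (1, 0)) = h z s / s"
    "snd (D z s (- \<kappa>, 1)) = h z s / s"
    "fst (D z s (- \<kappa>, 1)) + \<kappa> * snd (D z s (- \<kappa>, 1)) = \<mu> * snd (D z s (1, 0))" if "s > 0" for z s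
  proof -
    have "E * (fst (D z s (1, 0)) + \<kappa> * snd (D z s (1, 0))) = E * (h z s / s)"
      using killing_diag[OF that, of z "(1, 0)"] unfolding horizontal by simp
    then show "fst (D z s (1, 0)) + \<kappa> * snd (D z s (1, 0)) = h z s / s"
      using \<open>E \<noteq> 0\<close> by (metis mult_left_cancel)
    have "(E * \<mu>) * snd (D z s (- \<kappa>, 1)) = (E * \<mu>) * (h z s / s)"
      using killing_diag[OF that, of z "(- \<kappa>, 1)"] unfolding vertical by simp
    then show "snd (D z s (- \<kappa>, 1)) = h z s / s"
      using \<open>E \<noteq> 0\<close> \<open>\<mu> \<noteq> 0\<close> by (metis mult_left_cancel no_zero_divisors)
    have "E * (fst (D z s (- \<kappa>, 1)) + \<kappa> * snd (D z s (- \<kappa>, 1))) = E * (\<mu> * snd (D z s (1, 0)))"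
      using killing[OF that, of z "(1, 0)" "(- \<kappa>, 1)"] unfolding horizontal(2) vertical by simp
    then show "fst (D z s (- \<kappa>, 1)) + \<kappa> * snd (D z s (- \<kappa>, 1)) = \<mu> * snd (D z s (1, 0))"
      using \<open>E \<noteq> 0\<close> by (metis mult_left_cancel)
  qed
  have scale: "D z s (t *\<^sub>R u) = t *\<^sub>R D z s u" if "s > 0" for z s t u
    by (rule linear_scale[OF has_derivative_linear[OF DX[OF that]]])
  have Xz: "((\<lambda>z. X (?P z s)) has_derivative (\<lambda>t. t *\<^sub>R D z s (1, 0))) (at z)" if "s > 0" for z s
  proof -
    have "((\<lambda>z. ?P z s) has_derivative (\<lambda>t. t *\<^sub>R (1, 0))) (at z)"
      by (auto intro!: derivative_eq_intros)
    from has_derivative_compose[OF this DX[OF that]] show ?thesis unfolding scale[OF that] .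
  qed
  have Xs: "((\<lambda>s. X (?P z s)) has_derivative (\<lambda>t. t *\<^sub>R D z s (- \<kappa>, 1))) (at s)" if "s > 0" for z s
  proof -
    have "((\<lambda>s. ?P z s) has_derivative (\<lambda>t. t *\<^sub>R (- \<kappa>, 1))) (at s)"
      by (auto intro!: derivative_eq_intros)
    from has_derivative_compose[OF this DX[OF that]] show ?thesis unfolding scale[OF that] .
  qed
  have part: "((\<lambda>t. fst (Y t) + \<kappa> * snd (Y t)) has_real_derivative fst d + \<kappa> * snd d) (at t)"
    "((\<lambda>t. snd (Y t)) has_real_derivative snd d) (at t)"
    if "(Y has_derivative (\<lambda>t. t *\<^sub>R d)) (at t)" for Y :: "real \<Rightarrow> real \<times> real" and d t
    unfolding has_field_derivative_def
    by (auto intro!: derivative_eq_intros that simp: fun_eq_iff algebra_simps)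
  obtain p q r where f: "\<And>z s. s > 0 \<Longrightarrow> f z s = r + p * z + q * (z\<^sup>2 + \<mu> * s\<^sup>2) / 2"
    and h: "\<And>z s. s > 0 \<Longrightarrow> h z s = s * (p + q * z)"
  proof (rule killing_system_solution[of \<mu> f h "\<lambda>z s. snd (D z s (1, 0))"])
    fix z s :: real assume s: "s > 0"
    show "((\<lambda>z. f z s) has_real_derivative h z s / s) (at z)"
      using part(1)[OF Xz[OF s, of z]] unfolding f_def eqs(1)[OF s] .
    show "((\<lambda>s. f z s) has_real_derivative \<mu> * snd (D z s (1, 0))) (at s)"
      using part(1)[OF Xs[OF s, of z]] unfolding f_def eqs(3)[OF s] .
    show "((\<lambda>z. h z s) has_real_derivative snd (D z s (1, 0))) (at z)"
      using part(2)[OF Xz[OF s, of z]] unfolding h_def .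
    show "((\<lambda>s. h z s) has_real_derivative h z s / s) (at s)"
      using part(2)[OF Xs[OF s, of z]] unfolding h_def[of z s, symmetric] eqs(2)[OF s]
      by (simp add: h_def)
  qed (use assms that in auto)
  have "X (x, y) = mobius_field \<kappa> \<mu> p q r (x, y)" for x y
  proof (cases "y > 0")
    case True
    have "snd (X (x, y)) = y * (p + q * (x + \<kappa> * y))"
      using h[OF True, of "x + \<kappa> * y"] by (simp add: h_def)
    moreover have "fst (X (x, y)) + \<kappa> * snd (X (x, y)) =
        r + p * (x + \<kappa> * y) + q * ((x + \<kappa> * y)\<^sup>2 + \<mu> * y\<^sup>2) / 2"
      using f[OF True, of "x + \<kappa> * y"] by (simp add: f_def)
    ultimately show ?thesis using True
      by (simp add: mobius_field_def on_Aff_def Aff_def prod_eq_iff)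
        (simp add: field_simps power2_eq_square)
  next
    case False
    then show ?thesis using X
      by (simp add: killing_fields_def smooth_vfield_def mobius_field_def on_Aff_def Aff_def)
  qed
  then show ?thesis by (intro that) auto
qed

lemma killing_fields_half_plane_metric:
  assumes "E \<noteq> 0" "\<mu> \<noteq> 0"
  shows "killing_fields (half_plane_metric E (E * \<kappa>) (E * (\<kappa>\<^sup>2 - \<mu>))) =
    {mobius_field \<kappa> \<mu> p q r | p q r. True}"
proof (intro equalityI subsetI)
  show "X \<in> {mobius_field \<kappa> \<mu> p q r | p q r. True}"
    if "X \<in> killing_fields (half_plane_metric E (E * \<kappa>) (E * (\<kappa>\<^sup>2 - \<mu>)))" for X
    using killing_imp_mobius_field[OF assms that] by (metis (mono_tags) mem_Collect_eq)
qed (auto intro: mobius_field_killing)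

section \<open>The basis of right-invariant fields and one further field\<close>

lemma R1_eq_mobius_field: "R1 = mobius_field \<kappa> \<mu> 0 0 1"
  by (simp add: R1_def mobius_field_def)

lemma R2_eq_mobius_field: "R2 = mobius_field \<kappa> \<mu> 1 0 0"
  by (simp add: R2_def mobius_field_def)

text \<open>
  In terms of \<open>\<zeta> = z + j y\<close> with \<open>j\<^sup>2 = \<lambda>\<^sup>2\<close>, the fields \<open>X_plus\<close> and \<open>X_minus\<close> are
  \<open>((\<zeta> - \<kappa>)\<^sup>2 - \<lambda>\<^sup>2) / \<lambda> \<partial>\<^sub>\<zeta>\<close> for \<open>\<kappa> = \<nu>\<close> and \<open>\<kappa> = - \<nu>\<close>; the number \<open>w\<close> in their definition is
  \<open>(z - \<kappa>) / \<lambda>\<close>.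
\<close>

lemma X_plus_eq_mobius_field:
  assumes "lam A \<noteq> 0"
  shows "X_plus A = mobius_field (nu A) ((lam A)\<^sup>2)
    (- 2 * nu A / lam A) (2 / lam A) ((nu A)\<^sup>2 / lam A - lam A)"
  using assms
  by (simp add: X_plus_def mobius_field_def on_Aff_def fun_eq_iff Let_def)
    (simp add: field_simps power2_eq_square)

lemma X_minus_eq_mobius_field:
  assumes "lam A \<noteq> 0"
  shows "X_minus A = mobius_field (- nu A) ((lam A)\<^sup>2)
    (2 * nu A / lam A) (2 / lam A) ((nu A)\<^sup>2 / lam A - lam A)"
  using assms
  by (simp add: X_minus_def mobius_field_def on_Aff_def fun_eq_iff Let_def)
    (simp add: field_simps power2_eq_square)

lemma span_mobius_fields:
  assumes "l \<noteq> 0"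
  shows "span {R1, R2, mobius_field \<kappa> \<mu> p0 (2 / l) r0} =
    {mobius_field \<kappa> \<mu> p q r | p q r. True}" (is "span {R1, R2, ?X} = _")
proof (intro equalityI subsetI)
  have comb: "a *\<^sub>R R1 + b *\<^sub>R R2 + c *\<^sub>R ?X =
      mobius_field \<kappa> \<mu> (b + c * p0) (c * (2 / l)) (a + c * r0)" for a b c
    unfolding R1_eq_mobius_field[of \<kappa> \<mu>] R2_eq_mobius_field[of \<kappa> \<mu>]
    by (simp add: mobius_field_scaleR mobius_field_add)
  {
    fix Y assume "Y \<in> span {R1, R2, ?X}"
    then obtain a b c where "Y = a *\<^sub>R R1 + b *\<^sub>R R2 + c *\<^sub>R ?X"
      unfolding span_insert span_empty by (force simp: algebra_simps)
    then show "Y \<in> {mobius_field \<kappa> \<mu> p q r | p q r. True}" unfolding comb by blast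
  next
    fix Y assume "Y \<in> {mobius_field \<kappa> \<mu> p q r | p q r. True}"
    then obtain p q r where "Y = mobius_field \<kappa> \<mu> p q r" by blast
    also have "\<dots> = (r - l * q / 2 * r0) *\<^sub>R R1 + (p - l * q / 2 * p0) *\<^sub>R R2 + (l * q / 2) *\<^sub>R ?X"
      unfolding comb using assms by simp
    also have "\<dots> \<in> span {R1, R2, ?X}"
      by (intro span_add span_scale span_base) auto
    finally show "Y \<in> span {R1, R2, ?X}" .
  }
qed

lemma matrix_inv_2:
  fixes A :: "real^2^2"
  assumes "det A \<noteq> 0"
  shows "matrix_inv A = vector [vector [A$2$2 / det A, - A$1$2 / det A],
    vector [- A$2$1 / det A, A$1$1 / det A]]" (is "_ = ?B")
proof -
  have AB: "A ** ?B = mat 1"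
    using assms
    by (simp add: vec_eq_iff forall_2 matrix_matrix_mult_def sum_2 mat_def
        flip: add_divide_distrib diff_divide_distrib)
      (simp add: det_2 algebra_simps)
  have "A ** matrix_inv A = mat 1 \<and> matrix_inv A ** A = mat 1"
    unfolding matrix_inv_def
    by (rule someI_ex) (use assms in \<open>simp add: invertible_det_nz flip: invertible_def\<close>)
  then have left: "matrix_inv A ** A = mat 1" ..
  then have "matrix_inv A = matrix_inv A ** (A ** ?B)" unfolding AB by simp
  also have "\<dots> = ?B" by (simp add: matrix_mul_assoc left)
  finally show ?thesis .
qed

lemma lam_nu_eq:
  fixes A :: "real^2^2"
  assumes "det A \<noteq> 0"
  shows "lam A = det A / \<bar>(A$2$1)\<^sup>2 - (A$1$1)\<^sup>2\<bar>"
    and "nu A = (A$2$1 * A$2$2 - A$1$1 * A$1$2) / \<bar>(A$2$1)\<^sup>2 - (A$1$1)\<^sup>2\<bar>"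
proof -
  have "(- A$2$1 / det A)\<^sup>2 - (A$1$1 / det A)\<^sup>2 = ((A$2$1)\<^sup>2 - (A$1$1)\<^sup>2) / (det A)\<^sup>2"
    by (simp add: power_divide diff_divide_distrib)
  then have D: "(Dlt A)\<^sup>2 = \<bar>(A$2$1)\<^sup>2 - (A$1$1)\<^sup>2\<bar> / (det A)\<^sup>2"
    by (simp add: Dlt_def matrix_inv_2[OF assms] Let_def)
  have "A$2$2 / det A * (A$1$1 / det A) - - A$1$2 / det A * (- A$2$1 / det A) = det A / (det A)\<^sup>2"
    by (simp add: det_2[of A] power2_eq_square diff_divide_distrib mult.commute)
  then show "lam A = det A / \<bar>(A$2$1)\<^sup>2 - (A$1$1)\<^sup>2\<bar>"
    using assms by (simp add: lam_def D matrix_inv_2[OF assms] Let_def)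
  have "- A$1$2 / det A * (A$1$1 / det A) - A$2$2 / det A * (- A$2$1 / det A) =
      (A$2$1 * A$2$2 - A$1$1 * A$1$2) / (det A)\<^sup>2"
    by (simp add: power2_eq_square diff_divide_distrib mult.commute)
  then show "nu A = (A$2$1 * A$2$2 - A$1$1 * A$1$2) / \<bar>(A$2$1)\<^sup>2 - (A$1$1)\<^sup>2\<bar>"
    using assms by (simp add: nu_def D matrix_inv_2[OF assms] Let_def)
qed

theorem theorem18:
  fixes A :: "real^2^2" and K :: real
  assumes "det A > 0" and "A$1$1 \<ge> 0"
    and "\<forall>p\<in>Aff. sectional_curvature (aff_metric A) p = K" and "K \<noteq> 0"
  shows "let X = (if K > 0 then X_plus A else X_minus A); \<sigma> = sgn K in
    killing_fields (aff_metric A) = span {R1, R2, X} \<and>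
    lie_bracket R1 R2 = R1 \<and>
    lie_bracket R1 X = - (\<sigma> * (2 * nu A / lam A)) *\<^sub>R R1 + (2 / lam A) *\<^sub>R R2 \<and>
    lie_bracket R2 X = (2 * ((lam A)\<^sup>2 - (nu A)\<^sup>2) / lam A) *\<^sub>R R1
      + (\<sigma> * (2 * nu A / lam A)) *\<^sub>R R2 + X \<and>
    lie_isomorphic (killing_fields (aff_metric A)) lie_bracket sl2 commutator"
proof -
  define E where "E = (A$2$1)\<^sup>2 - (A$1$1)\<^sup>2"
  define F where "F = A$2$1 * A$2$2 - A$1$1 * A$1$2"
  define G where "G = (A$2$2)\<^sup>2 - (A$1$2)\<^sup>2"
  define \<sigma> where "\<sigma> = sgn K"
  define \<kappa> where "\<kappa> = \<sigma> * nu A"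
  define \<mu> where "\<mu> = (lam A)\<^sup>2"
  define X where "X = (if K > 0 then X_plus A else X_minus A)"
  have metric: "aff_metric A = half_plane_metric E F G"
    by (simp add: aff_metric_eq_half_plane_metric E_def F_def G_def)
  have disc: "E * G - F\<^sup>2 = - (det A)\<^sup>2"
    by (simp add: E_def F_def G_def det_2 algebra_simps power2_eq_square)
  have "K = E / (det A)\<^sup>2"
    using assms(1,3) sectional_curvature_half_plane_metric[of "(0, 1)" E G F]
    by (simp add: metric disc Aff_def)
  then have E: "E \<noteq> 0" and sgn: "sgn E = \<sigma>"
    using assms(1,4) by (auto simp: \<sigma>_def sgn_divide)
  have lam: "lam A = det A / \<bar>E\<bar>" and nu: "nu A = F / \<bar>E\<bar>"
    using lam_nu_eq[of A] assms(1) by (simp_all add: E_def F_def)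
  have lam_nz: "lam A \<noteq> 0" using assms(1) E by (simp add: lam)
  then have mu_nz: "\<mu> \<noteq> 0" by (simp add: \<mu>_def)
  have F: "F = E * \<kappa>"
    using E by (auto simp: \<kappa>_def nu simp flip: sgn simp: sgn_if)
  have "E\<^sup>2 * \<mu> = (det A)\<^sup>2" using E by (simp add: \<mu>_def lam power_divide)
  then have "E * G = E * (E * (\<kappa>\<^sup>2 - \<mu>))"
    using disc by (simp add: F algebra_simps power2_eq_square)
  then have G: "G = E * (\<kappa>\<^sup>2 - \<mu>)" using E by simp
  have sigma: "\<sigma> = 1 \<or> \<sigma> = - 1" using assms(4) by (auto simp: \<sigma>_def sgn_if)
  have X: "X = mobius_field \<kappa> \<mu> (- 2 * \<kappa> / lam A) (2 / lam A) (\<kappa>\<^sup>2 / lam A - lam A)"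
    using assms(4) X_plus_eq_mobius_field[OF lam_nz] X_minus_eq_mobius_field[OF lam_nz]
    by (auto simp: X_def \<kappa>_def \<mu>_def \<sigma>_def sgn_if)
  note R1 = R1_eq_mobius_field[of \<kappa> \<mu>] and R2 = R2_eq_mobius_field[of \<kappa> \<mu>]
  have killing: "killing_fields (aff_metric A) = {mobius_field \<kappa> \<mu> p q r | p q r. True}"
    unfolding metric F G by (rule killing_fields_half_plane_metric[OF E mu_nz])
  have "killing_fields (aff_metric A) = span {R1, R2, X}"
    unfolding killing X by (rule span_mobius_fields[OF lam_nz, symmetric])
  moreover have "lie_bracket R1 R2 = R1"
    unfolding R1 R2 lie_bracket_mobius_field by simp
  moreover have "lie_bracket R1 X = - (\<sigma> * (2 * nu A / lam A)) *\<^sub>R R1 + (2 / lam A) *\<^sub>R R2"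
    unfolding R1 R2 X lie_bracket_mobius_field mobius_field_scaleR mobius_field_add
    by (simp add: \<kappa>_def mult.left_commute)
  moreover have "lie_bracket R2 X = (2 * ((lam A)\<^sup>2 - (nu A)\<^sup>2) / lam A) *\<^sub>R R1
      + (\<sigma> * (2 * nu A / lam A)) *\<^sub>R R2 + X"
  proof -
    have "\<kappa>\<^sup>2 = (nu A)\<^sup>2" using sigma by (auto simp: \<kappa>_def)
    then have "lam A - \<kappa>\<^sup>2 / lam A = 2 * ((lam A)\<^sup>2 - (nu A)\<^sup>2) / lam A + (\<kappa>\<^sup>2 / lam A - lam A)"
      using lam_nz by (simp add: field_simps power2_eq_square)
    moreover have "lie_bracket R2 X = mobius_field \<kappa> \<mu> 0 (2 / lam A) (lam A - \<kappa>\<^sup>2 / lam A)"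
      unfolding R2 X lie_bracket_mobius_field by simp
    moreover have "(2 * ((lam A)\<^sup>2 - (nu A)\<^sup>2) / lam A) *\<^sub>R R1 + (\<sigma> * (2 * nu A / lam A)) *\<^sub>R R2 + X =
        mobius_field \<kappa> \<mu> 0 (2 / lam A)
          (2 * ((lam A)\<^sup>2 - (nu A)\<^sup>2) / lam A + (\<kappa>\<^sup>2 / lam A - lam A))"
      unfolding R1 R2 X mobius_field_scaleR mobius_field_add by (simp add: \<kappa>_def)
    ultimately show ?thesis by (simp only:)
  qed
  moreover have "lie_isomorphic (killing_fields (aff_metric A)) lie_bracket sl2 commutator"
    unfolding killing by (rule lie_isomorphic_mobius_fields)
  ultimately show ?thesis
    unfolding Let_def X_def[symmetric] \<sigma>_def[symmetric] by blast
qed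

end
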